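(* For all integers $n\ge1$ and $m\ge1$, $$\Gamma_{n-1,m}\,\hat E_{n,m}\,I^1_{n-1,m}=A_{n,m-1}\,\mathcal K_{n,m}-\mathcal K_{n-1,m}\,\tilde\Gamma^1_{n-1,m}$$ and $$\tilde\Gamma_{n,m-1}\,\hat{\tilde E}_{n,m}\,\tilde I^1_{n,m-1}=\tilde A_{n-1,m}\,\tilde{\mathcal K}_{n,m}-\tilde{\mathcal K}_{n,m-1}\,\Gamma^1_{n,m-1}.$$
   Context: Let $\sigma$ be a positive Borel measure on the bi-circle $\mathbb T^2=\{(z,w):|z|=|w|=1\}$ such that for all $n,m\ge0$ the moment (Gram) matrix of the monomials $z^iw^j$, $0\le i\le n$, $0\le j\le m$, in $L^2(\sigma)$ is positive definite. Orthonormal polynomials. For $n,m\ge 0$ and $0\le l\le m$, $\phi^l_{n,m}(z,w)$ is the unique polynomial in the span of the monomials $z^iw^j$ with ($0\le i<n$, $0\le j\le m$) or ($i=n$, $0\le j\le l$), with positive coefficient of $z^nw^l$, of norm $1$ in $L^2(\sigma)$, and orthogonal in $L^2(\sigma)$ to $z^iw^j$ for ($0\le i<n$, $0\le j\le m$) and for ($i=n$, $0\le j<l$). For $0\le l\le n$, $\tilde\phi^l_{n,m}(z,w)$ is defined in the same way with the roles of $z$ and $w$ (and of $n$ and $m$) interchanged: it lies in the span of $z^iw^j$ with ($0\le j<m$, $0\le i\le n$) or ($j=m$, $0\le i\le l$), has positive coefficient of $z^lw^m$, has norm $1$, and is orthogonal to $z^iw^j$ for ($0\le j<m$, $0\le i\le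 n$) and for ($j=m$, $0\le i<l$). Put the column vectors $\Phi_{n,m}=[\phi^m_{n,m},\phi^{m-1}_{n,m},\dots,\phi^0_{n,m}]^T$ (length $m+1$) and $\tilde\Phi_{n,m}=[\tilde\phi^n_{n,m},\dots,\tilde\phi^0_{n,m}]^T$ (length $n+1$). Reverses. For an entry $\phi$ of a vector with index $(n,m)$, $\overleftarrow\phi(z,w)=z^nw^m\,\overline{\phi(1/\bar z,1/\bar w)}$. $\overleftarrow\Phi_{n,m}^T$ and $\overleftarrow{\tilde\Phi}_{n,m}^T$ denote the column vectors of the reverses of the entries of $\Phi_{n,m}$ and $\tilde\Phi_{n,m}$ (in the same order). Inner product. For column vectors of polynomials $X,Y$, $\langle X,Y\rangle=\int_{\mathbb T^2}X\,Y^\dagger\,d\sigma$, where $\dagger$ is conjugate transpose and $T$ is transpose. Recurrence coefficients. $\hat E_{n,m}=\langle z\Phi_{n-1,m},\overleftarrow\Phi_{n-1,m}^T\rangle$ and $A_{n,m}=\langle z\Phi_{n-1,m},\Phi_{n,m}\rangle$, of size $(m+1)\times(m+1)$; $\mathcal K_{n,m}=\langle\Phi_{n,m-1},\tilde\Phi_{n-1,m}\rangle$, of size $m\times n$; $\Gamma_{n,m}=\langle\Phi_{n,m-1},\Phi_{n,m}\rangle$ and $\Gamma^1_{n,m}=\langle w\Phi_{n,m-1},\Phi_{n,m}\rangle$, of size $m\times(m+1)$; $I^1_{n,m}=\langle\overleftarrow\Phi_{n,m}^T,\tilde\Phi_{n,m}\rangle$, of size $(m+1)\times(n+1)$. The tilde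 versions are obtained by interchanging the roles of $z,w$, of $n,m$, and of tilded and untilded polynomials: $\hat{\tilde E}_{n,m}=\langle w\tilde\Phi_{n,m-1},\overleftarrow{\tilde\Phi}_{n,m-1}^T\rangle$ and $\tilde A_{n,m}=\langle w\tilde\Phi_{n,m-1},\tilde\Phi_{n,m}\rangle$, of size $(n+1)\times(n+1)$; $\tilde{\mathcal K}_{n,m}=\langle\tilde\Phi_{n-1,m},\Phi_{n,m-1}\rangle$, of size $n\times m$; $\tilde\Gamma_{n,m}=\langle\tilde\Phi_{n-1,m},\tilde\Phi_{n,m}\rangle$ and $\tilde\Gamma^1_{n,m}=\langle z\tilde\Phi_{n-1,m},\tilde\Phi_{n,m}\rangle$, of size $n\times(n+1)$; $\tilde I^1_{n,m}=\langle\overleftarrow{\tilde\Phi}_{n,m}^T,\Phi_{n,m}\rangle$, of size $(n+1)\times(m+1)$. Convention: matrices with an index equal to $0$ that makes them empty (e.g. $\mathcal K_{0,m}$, of size $m\times 0$) are empty, and products through an empty dimension are zero matrices. *)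

theory Defs
  imports
    "HOL-Analysis.Bochner_Integration"
    "HOL-Computational_Algebra.Polynomial"
    "Jordan_Normal_Form.Matrix"
begin

text \<open>
  The order on \<^typ>\<open>complex\<close> is the one of \<^theory>\<open>HOL-Library.Complex_Order\<close>: for a complex
  number \<open>c\<close>, \<open>0 < c\<close> says that \<open>c\<close> is real and positive.
\<close>

definition bicircle :: "(complex \<times> complex) set" where
  "bicircle = sphere 0 1 \<times> sphere 0 1"

definition l2_inner ::
  "(complex \<times> complex) measure \<Rightarrow> (complex \<times> complex \<Rightarrow> complex)
     \<Rightarrow> (complex \<times> complex \<Rightarrow> complex) \<Rightarrow> complex" where
  "l2_inner \<sigma> f g = (\<integral>x. f x * cnj (g x) \<partial>\<sigma>)"

definition zw_monom :: "nat \<times> nat \<Rightarrow> complex \<times> complex \<Rightarrow> complex" where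
  "zw_monom = (\<lambda>(i, j) (z, w). z ^ i * w ^ j)"

definition moment_matrix ::
  "(complex \<times> complex) measure \<Rightarrow> nat \<times> nat \<Rightarrow> nat \<times> nat \<Rightarrow> complex" where
  "moment_matrix \<sigma> a b = l2_inner \<sigma> (zw_monom a) (zw_monom b)"

text \<open>Positive definiteness of the complex matrix \<open>G\<close> with rows and columns indexed by the finite
  set \<open>I\<close>. Hermitian symmetry need not be required separately: it follows because the quadratic
  form is real.\<close>

definition pos_def_on :: "'i set \<Rightarrow> ('i \<Rightarrow> 'i \<Rightarrow> complex) \<Rightarrow> bool" where
  "pos_def_on I G \<longleftrightarrow>
     (\<forall>c. (\<exists>a\<in>I. c a \<noteq> 0) \<longrightarrow> 0 < (\<Sum>a\<in>I. \<Sum>b\<in>I. cnj (c a) * G a b * c b))"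

text \<open>A positive Borel measure on the bi-circle with positive definite moment matrices. Such a
  measure is finite: the Bochner integral of a non-integrable function is 0, so positivity of the
  moment with index \<open>((0, 0), (0, 0))\<close> makes the constant 1 integrable.\<close>

definition nondegenerate_bicircle_measure :: "(complex \<times> complex) measure \<Rightarrow> bool" where
  "nondegenerate_bicircle_measure \<sigma> \<longleftrightarrow>
     sets \<sigma> = sets (restrict_space borel bicircle) \<and>
     (\<forall>n m. pos_def_on ({0..n} \<times> {0..m}) (moment_matrix \<sigma>))"

text \<open>A polynomial in \<open>z, w\<close> is a polynomial in \<open>z\<close> (outer variable) whose coefficients are
  polynomials in \<open>w\<close>; so \<open>bicoeff p (i, j)\<close> is the coefficient of \<open>z ^ i * w ^ j\<close>.\<close>

definition bicoeff :: "complex poly poly \<Rightarrow> nat \<times> nat \<Rightarrow> complex" where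
  "bicoeff p = (\<lambda>(i, j). poly.coeff (poly.coeff p i) j)"

definition bieval :: "complex poly poly \<Rightarrow> complex \<times> complex \<Rightarrow> complex" where
  "bieval p = (\<lambda>(z, w). poly (poly p [:z:]) w)"

text \<open>\<open>p\<close> lies in the span of the monomials with exponents in \<open>insert k S\<close>, has positive coefficient
  at \<open>k\<close>, has norm 1 and is orthogonal to the monomials with exponents in \<open>S\<close>.\<close>

definition is_orthonormal_poly ::
  "(complex \<times> complex) measure \<Rightarrow> (nat \<times> nat) set \<Rightarrow> nat \<times> nat \<Rightarrow> complex poly poly \<Rightarrow> bool" where
  "is_orthonormal_poly \<sigma> S k p \<longleftrightarrow>
     (\<forall>a. bicoeff p a \<noteq> 0 \<longrightarrow> a \<in> insert k S) \<and>
     0 < bicoeff p k \<and>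
     l2_inner \<sigma> (bieval p) (bieval p) = 1 \<and>
     (\<forall>a\<in>S. l2_inner \<sigma> (bieval p) (zw_monom a) = 0)"

definition phi ::
  "(complex \<times> complex) measure \<Rightarrow> nat \<Rightarrow> nat \<Rightarrow> nat \<Rightarrow> complex poly poly" where
  "phi \<sigma> n m l =
     (THE p. is_orthonormal_poly \<sigma> {(i, j). i < n \<and> j \<le> m \<or> i = n \<and> j < l} (n, l) p)"

definition phi_tilde ::
  "(complex \<times> complex) measure \<Rightarrow> nat \<Rightarrow> nat \<Rightarrow> nat \<Rightarrow> complex poly poly" where
  "phi_tilde \<sigma> n m l =
     (THE p. is_orthonormal_poly \<sigma> {(i, j). j < m \<and> i \<le> n \<or> j = m \<and> i < l} (l, m) p)"

type_synonym fvec = "(complex \<times> complex \<Rightarrow> complex) vec"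

definition Phi :: "(complex \<times> complex) measure \<Rightarrow> nat \<Rightarrow> nat \<Rightarrow> fvec" where
  "Phi \<sigma> n m = vec (m + 1) (\<lambda>i. bieval (phi \<sigma> n m (m - i)))"

definition Phi_tilde :: "(complex \<times> complex) measure \<Rightarrow> nat \<Rightarrow> nat \<Rightarrow> fvec" where
  "Phi_tilde \<sigma> n m = vec (n + 1) (\<lambda>i. bieval (phi_tilde \<sigma> n m (n - i)))"

definition zmul :: "fvec \<Rightarrow> fvec" where
  "zmul = map_vec (\<lambda>f (z, w). z * f (z, w))"

definition wmul :: "fvec \<Rightarrow> fvec" where
  "wmul = map_vec (\<lambda>f (z, w). w * f (z, w))"

text \<open>The reverse is a polynomial function where \<open>z\<close> and \<open>w\<close> are non-zero, in particular on the
  bi-circle; only its values there are used.\<close>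

definition rev_fun ::
  "nat \<Rightarrow> nat \<Rightarrow> (complex \<times> complex \<Rightarrow> complex) \<Rightarrow> complex \<times> complex \<Rightarrow> complex" where
  "rev_fun n m f = (\<lambda>(z, w). z ^ n * w ^ m * cnj (f (1 / cnj z, 1 / cnj w)))"

definition revPhi :: "(complex \<times> complex) measure \<Rightarrow> nat \<Rightarrow> nat \<Rightarrow> fvec" where
  "revPhi \<sigma> n m = map_vec (rev_fun n m) (Phi \<sigma> n m)"

definition revPhi_tilde :: "(complex \<times> complex) measure \<Rightarrow> nat \<Rightarrow> nat \<Rightarrow> fvec" where
  "revPhi_tilde \<sigma> n m = map_vec (rev_fun n m) (Phi_tilde \<sigma> n m)"

definition ip :: "(complex \<times> complex) measure \<Rightarrow> fvec \<Rightarrow> fvec \<Rightarrow> complex mat" where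
  "ip \<sigma> X Y = mat (dim_vec X) (dim_vec Y) (\<lambda>(i, j). l2_inner \<sigma> (X $ i) (Y $ j))"

text \<open>Where an index equal to 0 makes a coefficient matrix empty, this is stated explicitly, since
  \<open>0 - 1 = 0\<close> on \<^typ>\<open>nat\<close> would give a matrix of the wrong size. \<open>E_hat\<close> and \<open>A_mat\<close> are meaningful for
  \<open>n \<ge> 1\<close> only, \<open>E_tilde_hat\<close> and \<open>A_tilde\<close> for \<open>m \<ge> 1\<close> only.\<close>

definition E_hat :: "(complex \<times> complex) measure \<Rightarrow> nat \<Rightarrow> nat \<Rightarrow> complex mat" where
  "E_hat \<sigma> n m = ip \<sigma> (zmul (Phi \<sigma> (n - 1) m)) (revPhi \<sigma> (n - 1) m)"

definition A_mat :: "(complex \<times> complex) measure \<Rightarrow> nat \<Rightarrow> nat \<Rightarrow> complex mat" where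
  "A_mat \<sigma> n m = ip \<sigma> (zmul (Phi \<sigma> (n - 1) m)) (Phi \<sigma> n m)"

definition K_mat :: "(complex \<times> complex) measure \<Rightarrow> nat \<Rightarrow> nat \<Rightarrow> complex mat" where
  "K_mat \<sigma> n m = (if n = 0 \<or> m = 0 then 0\<^sub>m m n else ip \<sigma> (Phi \<sigma> n (m - 1)) (Phi_tilde \<sigma> (n - 1) m))"

definition Gamma :: "(complex \<times> complex) measure \<Rightarrow> nat \<Rightarrow> nat \<Rightarrow> complex mat" where
  "Gamma \<sigma> n m = (if m = 0 then 0\<^sub>m 0 (m + 1) else ip \<sigma> (Phi \<sigma> n (m - 1)) (Phi \<sigma> n m))"

definition Gamma1 :: "(complex \<times> complex) measure \<Rightarrow> nat \<Rightarrow> nat \<Rightarrow> complex mat" where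
  "Gamma1 \<sigma> n m = (if m = 0 then 0\<^sub>m 0 (m + 1) else ip \<sigma> (wmul (Phi \<sigma> n (m - 1))) (Phi \<sigma> n m))"

definition I1 :: "(complex \<times> complex) measure \<Rightarrow> nat \<Rightarrow> nat \<Rightarrow> complex mat" where
  "I1 \<sigma> n m = ip \<sigma> (revPhi \<sigma> n m) (Phi_tilde \<sigma> n m)"

definition E_tilde_hat :: "(complex \<times> complex) measure \<Rightarrow> nat \<Rightarrow> nat \<Rightarrow> complex mat" where
  "E_tilde_hat \<sigma> n m = ip \<sigma> (wmul (Phi_tilde \<sigma> n (m - 1))) (revPhi_tilde \<sigma> n (m - 1))"

definition A_tilde :: "(complex \<times> complex) measure \<Rightarrow> nat \<Rightarrow> nat \<Rightarrow> complex mat" where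
  "A_tilde \<sigma> n m = ip \<sigma> (wmul (Phi_tilde \<sigma> n (m - 1))) (Phi_tilde \<sigma> n m)"

definition K_tilde :: "(complex \<times> complex) measure \<Rightarrow> nat \<Rightarrow> nat \<Rightarrow> complex mat" where
  "K_tilde \<sigma> n m =
     (if n = 0 \<or> m = 0 then 0\<^sub>m n m else ip \<sigma> (Phi_tilde \<sigma> (n - 1) m) (Phi \<sigma> n (m - 1)))"

definition Gamma_tilde :: "(complex \<times> complex) measure \<Rightarrow> nat \<Rightarrow> nat \<Rightarrow> complex mat" where
  "Gamma_tilde \<sigma> n m =
     (if n = 0 then 0\<^sub>m 0 (n + 1) else ip \<sigma> (Phi_tilde \<sigma> (n - 1) m) (Phi_tilde \<sigma> n m))"

definition Gamma1_tilde :: "(complex \<times> complex) measure \<Rightarrow> nat \<Rightarrow> nat \<Rightarrow> complex mat" where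
  "Gamma1_tilde \<sigma> n m =
     (if n = 0 then 0\<^sub>m 0 (n + 1) else ip \<sigma> (zmul (Phi_tilde \<sigma> (n - 1) m)) (Phi_tilde \<sigma> n m))"

definition I1_tilde :: "(complex \<times> complex) measure \<Rightarrow> nat \<Rightarrow> nat \<Rightarrow> complex mat" where
  "I1_tilde \<sigma> n m = ip \<sigma> (revPhi_tilde \<sigma> n m) (Phi \<sigma> n m)"

end

theory Submission
  imports Defs
begin

text \<open>
  Both identities compute \<open>X = \<langle>z \<Phi>\<^bsub>n-1,m-1\<^esub>, \<Phi>~\<^bsub>n-1,m\<^esub>\<rangle>\<close> (or its mirror image) in two ways. Expanding
  \<open>z \<Phi>\<^bsub>n-1,m-1\<^esub>\<close> along \<open>\<Phi>\<^bsub>n,m-1\<^esub>\<close> leaves a remainder of degree at most \<open>(n-1, m-1)\<close>, which is orthogonal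
  to \<open>\<Phi>~\<^bsub>n-1,m\<^esub>\<close>; so \<open>X\<close> is the product of \<open>A\<close> and \<open>K\<close>. On the other hand
  \<open>\<Phi>\<^bsub>n-1,m-1\<^esub> = \<Gamma> \<Phi>\<^bsub>n-1,m\<^esub> + K \<Phi>~\<^bsub>n-2,m\<^esub>\<close>, and
  \<open>\<langle>z \<Phi>\<^bsub>n-1,m\<^esub>, \<Phi>~\<^bsub>n-1,m\<^esub>\<rangle>\<close> is the product of \<open>E\<close> and \<open>I\<^sup>1\<close>, because the reverses of
  \<open>\<Phi>\<^bsub>n-1,m\<^esub>\<close> are an orthonormal basis of the polynomials of degree at most \<open>(n-1, m)\<close> modulo the
  multiples of \<open>z\<close>, to which \<open>z \<Phi>\<^bsub>n-1,m\<^esub>\<close> is orthogonal.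
\<close>

section \<open>Coefficients and values of bivariate polynomials\<close>

lemma bicoeff_diff: "bicoeff (p - q) a = bicoeff p a - bicoeff q a"
  by (cases a) (simp add: bicoeff_def)

lemma bicoeff_smult: "bicoeff (Polynomial.smult [:c:] p) a = c * bicoeff p a"
  by (cases a) (simp add: bicoeff_def)

lemma bieval_smult: "bieval (Polynomial.smult [:c:] p) = (\<lambda>x. c * bieval p x)"
  by (auto simp: bieval_def)

lemma bipoly_eqI: "(\<And>a. bicoeff p a = bicoeff q a) \<Longrightarrow> p = q"
  by (intro poly_eqI) (auto simp: bicoeff_def dest: spec)

definition bipoly :: "(nat \<times> nat) set \<Rightarrow> (nat \<times> nat \<Rightarrow> complex) \<Rightarrow> complex poly poly" where
  "bipoly S c = (\<Sum>a\<in>S. Polynomial.monom (Polynomial.monom (c a) (snd a)) (fst a))"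

lemma bicoeff_bipoly:
  assumes "finite S"
  shows "bicoeff (bipoly S c) a = (if a \<in> S then c a else 0)"
proof -
  have "bicoeff (bipoly S c) a = (\<Sum>b\<in>S. if b = a then c b else 0)"
    unfolding bicoeff_def bipoly_def
    by (cases a) (auto simp: coeff_sum intro!: sum.cong)
  then show ?thesis
    using assms by simp
qed

lemma bieval_bipoly: "bieval (bipoly S c) = (\<lambda>x. \<Sum>a\<in>S. c a * zw_monom a x)"
proof
  fix x :: "complex \<times> complex"
  show "bieval (bipoly S c) x = (\<Sum>a\<in>S. c a * zw_monom a x)"
    by (cases x) (auto simp: bieval_def bipoly_def zw_monom_def poly_sum poly_monom
        poly_power case_prod_beta intro!: sum.cong)
qed

lemma bieval_eq_sum_bicoeff:
  assumes "finite S" "\<And>a. bicoeff p a \<noteq> 0 \<Longrightarrow> a \<in> S"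
  shows "bieval p = (\<lambda>x. \<Sum>a\<in>S. bicoeff p a * zw_monom a x)"
proof -
  have "p = bipoly S (bicoeff p)"
    using assms by (intro bipoly_eqI) (auto simp: bicoeff_bipoly)
  then show ?thesis
    by (metis bieval_bipoly)
qed

section \<open>Spans of monomials as functions on the bi-circle\<close>

text \<open>Equality is asked on \<open>bicircle\<close> only: integrals see nothing else, and the
  functions produced by \<open>rev_fun\<close> agree with polynomials only away from zero
  coordinates.\<close>

definition zw_span :: "(nat \<times> nat) set \<Rightarrow> (complex \<times> complex \<Rightarrow> complex) set" where
  "zw_span S = {f. \<exists>c. \<forall>x\<in>bicircle. f x = (\<Sum>a\<in>S. c a * zw_monom a x)}"

lemma zw_spanI: "(\<And>x. x \<in> bicircle \<Longrightarrow> f x = (\<Sum>a\<in>S. c a * zw_monom a x)) \<Longrightarrow> f \<in> zw_span S"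
  by (auto simp: zw_span_def)

lemma zw_spanE:
  assumes "f \<in> zw_span S"
  obtains c where "\<And>x. x \<in> bicircle \<Longrightarrow> f x = (\<Sum>a\<in>S. c a * zw_monom a x)"
  using assms by (auto simp: zw_span_def)

lemma zw_span_diff:
  assumes "f \<in> zw_span S" "g \<in> zw_span S"
  shows "(\<lambda>x. f x - g x) \<in> zw_span S"
proof -
  obtain c d where "\<And>x. x \<in> bicircle \<Longrightarrow> f x = (\<Sum>a\<in>S. c a * zw_monom a x)"
    "\<And>x. x \<in> bicircle \<Longrightarrow> g x = (\<Sum>a\<in>S. d a * zw_monom a x)"
    using assms by (auto elim!: zw_spanE)
  then show ?thesis
    by (intro zw_spanI[where c = "\<lambda>a. c a - d a"]) (simp add: sum_subtractf left_diff_distrib)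
qed

lemma zw_span_scale:
  assumes "f \<in> zw_span S"
  shows "(\<lambda>x. t * f x) \<in> zw_span S"
proof -
  obtain c where "\<And>x. x \<in> bicircle \<Longrightarrow> f x = (\<Sum>a\<in>S. c a * zw_monom a x)"
    using assms by (auto elim!: zw_spanE)
  then show ?thesis
    by (intro zw_spanI[where c = "\<lambda>a. t * c a"]) (simp add: sum_distrib_left mult.assoc)
qed

lemma zw_span_zero: "(\<lambda>x. 0) \<in> zw_span S"
  by (rule zw_spanI[where c = "\<lambda>_. 0"]) simp

lemma zw_span_sum:
  assumes "\<And>i. i \<in> I \<Longrightarrow> f i \<in> zw_span S"
  shows "(\<lambda>x. \<Sum>i\<in>I. f i x) \<in> zw_span S"
proof (cases "finite I")
  case True
  then show ?thesis
    using assms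
  proof (induction I)
    case (insert i I)
    have "(\<lambda>x. f i x - (- 1) * (\<Sum>i\<in>I. f i x)) \<in> zw_span S"
      using insert by (intro zw_span_diff zw_span_scale) auto
    then show ?case
      using insert by simp
  qed (simp add: zw_span_zero)
qed (simp add: zw_span_zero)

lemma zw_span_mono:
  assumes "f \<in> zw_span S" "S \<subseteq> T" "finite T"
  shows "f \<in> zw_span T"
proof -
  obtain c where c: "\<And>x. x \<in> bicircle \<Longrightarrow> f x = (\<Sum>a\<in>S. c a * zw_monom a x)"
    using assms by (auto elim!: zw_spanE)
  have "(\<Sum>a\<in>S. c a * zw_monom a x) = (\<Sum>a\<in>T. (if a \<in> S then c a else 0) * zw_monom a x)" for x
    using assms by (intro sum.mono_neutral_cong_left) auto
  then show ?thesis
    using c by (intro zw_spanI[where c = "\<lambda>a. if a \<in> S then c a else 0"]) simp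
qed

lemma zw_monom_in_span:
  assumes "a \<in> S" "finite S"
  shows "zw_monom a \<in> zw_span S"
proof (rule zw_spanI)
  fix x
  have "(\<Sum>b\<in>S. (if b = a then 1 else 0) * zw_monom b x) = (\<Sum>b\<in>S. if b = a then zw_monom b x else 0)"
    by (intro sum.cong) auto
  then show "zw_monom a x = (\<Sum>b\<in>S. (if b = a then 1 else 0) * zw_monom b x)"
    using assms by simp
qed

lemma bieval_in_span:
  assumes "finite S" "\<And>a. bicoeff p a \<noteq> 0 \<Longrightarrow> a \<in> S"
  shows "bieval p \<in> zw_span S"
  using bieval_eq_sum_bicoeff[OF assms] by (intro zw_spanI[where c = "bicoeff p"]) simp

text \<open>One step of Gaussian elimination: \<open>t\<close> is the quotient of the coefficients
  at \<open>k\<close>. Iterating it downwards expands a function along a triangular family.\<close>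

lemma zw_span_cancel_leading:
  assumes "f \<in> zw_span (insert k S)" "finite S" "k \<notin> S"
    and p: "\<And>a. bicoeff p a \<noteq> 0 \<Longrightarrow> a \<in> insert k S" "bicoeff p k \<noteq> 0"
  obtains t where "(\<lambda>x. f x - t * bieval p x) \<in> zw_span S"
proof -
  obtain c where c: "\<And>x. x \<in> bicircle \<Longrightarrow> f x = (\<Sum>a\<in>insert k S. c a * zw_monom a x)"
    using assms by (auto elim!: zw_spanE)
  have e: "bieval p = (\<lambda>x. \<Sum>a\<in>insert k S. bicoeff p a * zw_monom a x)"
    using assms by (intro bieval_eq_sum_bicoeff) auto
  define t where "t = c k / bicoeff p k"
  have "(\<lambda>x. f x - t * bieval p x) \<in> zw_span S"
    using assms c unfolding e
    by (intro zw_spanI[where c = "\<lambda>a. c a - t * bicoeff p a"])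
      (simp add: algebra_simps sum_subtractf sum_distrib_left t_def)
  then show ?thesis
    by (rule that)
qed

lemma continuous_on_zw_monom: "continuous_on A (zw_monom a)"
  unfolding zw_monom_def case_prod_beta by (intro continuous_intros)

lemma continuous_on_zw_span:
  assumes "f \<in> zw_span S"
  shows "continuous_on bicircle f"
proof -
  obtain c where c: "\<And>x. x \<in> bicircle \<Longrightarrow> f x = (\<Sum>a\<in>S. c a * zw_monom a x)"
    using assms by (auto elim!: zw_spanE)
  show ?thesis
    by (subst continuous_on_cong[OF refl c]) (auto intro!: continuous_intros continuous_on_zw_monom)
qed

section \<open>The inner product and the nondegeneracy of its moments\<close>

locale bicircle_measure =
  fixes \<sigma> :: "(complex \<times> complex) measure"
  assumes nondegenerate: "nondegenerate_bicircle_measure \<sigma>"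
begin

abbreviation inn :: "(complex \<times> complex \<Rightarrow> complex) \<Rightarrow> (complex \<times> complex \<Rightarrow> complex) \<Rightarrow> complex" where
  "inn \<equiv> l2_inner \<sigma>"

lemma space_eq: "space \<sigma> = bicircle"
  using nondegenerate sets_eq_imp_space_eq[of \<sigma> "restrict_space borel bicircle"]
  by (simp add: nondegenerate_bicircle_measure_def space_restrict_space)

lemma finite_measure: "finite_measure \<sigma>"
proof -
  have "pos_def_on ({0..0} \<times> {0..0}) (moment_matrix \<sigma>)"
    using nondegenerate unfolding nondegenerate_bicircle_measure_def by blast
  then have "0 < moment_matrix \<sigma> (0, 0) (0, 0)"
    unfolding pos_def_on_def by (drule_tac spec[of _ "\<lambda>_. 1"]) auto
  then have "measure \<sigma> (space \<sigma>) \<noteq> 0"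
    by (auto simp: moment_matrix_def l2_inner_def zw_monom_def case_prod_beta)
  \<comment> \<open>\<open>measure\<close> sends an infinite \<open>emeasure\<close> to 0, so a
    nonzero value excludes infinite mass.\<close>
  then have "emeasure \<sigma> (space \<sigma>) \<noteq> \<infinity>"
    by (auto simp: measure_def)
  then show ?thesis
    by (rule finite_measureI)
qed

text \<open>A continuous function on the compact bi-circle is bounded, and the measure is finite.
  This settles all integrability questions below.\<close>

lemma integrable_continuous:
  assumes "continuous_on bicircle f"
  shows "integrable \<sigma> (f :: complex \<times> complex \<Rightarrow> complex)"
proof -
  interpret finite_measure \<sigma>
    by (rule finite_measure)
  have "compact (f ` bicircle)"
    using assms by (intro compact_continuous_image) (simp_all add: bicircle_def compact_Times)
  then obtain B where B: "\<And>x. x \<in> bicircle \<Longrightarrow> norm (f x) \<le> B"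
    by (meson bounded_iff compact_imp_bounded imageI)
  have "f \<in> borel_measurable (restrict_space borel bicircle)"
    using assms by (rule borel_measurable_continuous_on_restrict)
  then have "f \<in> borel_measurable \<sigma>"
    using nondegenerate measurable_cong_sets
    by (metis nondegenerate_bicircle_measure_def)
  then show ?thesis
    using B by (intro integrable_const_bound[where B = B]) (auto simp: space_eq)
qed

text \<open>The hypothesis compares products rather than factors, so that unimodular factors can be
  moved from one argument to the other or cancelled.\<close>

lemma inn_cong:
  assumes "\<And>x. x \<in> bicircle \<Longrightarrow> f x * cnj (g x) = f' x * cnj (g' x)"
  shows "inn f g = inn f' g'"
  unfolding l2_inner_def using assms by (intro Bochner_Integration.integral_cong) (auto simp: space_eq)

lemma inn_commute: "cnj (inn f g) = inn g f"
  unfolding l2_inner_def by (subst integral_cnj [symmetric]) (simp add: mult.commute)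

lemma inn_sum_left:
  assumes "\<And>i. i \<in> I \<Longrightarrow> continuous_on bicircle (f i)" "continuous_on bicircle g"
  shows "inn (\<lambda>x. \<Sum>i\<in>I. c i * f i x) g = (\<Sum>i\<in>I. c i * inn (f i) g)"
proof -
  have "inn (\<lambda>x. \<Sum>i\<in>I. c i * f i x) g = (\<integral>x. (\<Sum>i\<in>I. c i * (f i x * cnj (g x))) \<partial>\<sigma>)"
    by (simp add: l2_inner_def sum_distrib_right mult.assoc)
  also have "\<dots> = (\<Sum>i\<in>I. c i * inn (f i) g)"
    unfolding l2_inner_def using assms
    by (subst Bochner_Integration.integral_sum) (auto intro!: integrable_continuous continuous_intros)
  finally show ?thesis .
qed

lemma inn_diff_left:
  assumes "continuous_on bicircle f" "continuous_on bicircle f'" "continuous_on bicircle g"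
  shows "inn (\<lambda>x. f x - f' x) g = inn f g - inn f' g"
  unfolding l2_inner_def left_diff_distrib using assms
  by (intro Bochner_Integration.integral_diff) (auto intro!: integrable_continuous continuous_intros)

lemma inn_scale_left: "inn (\<lambda>x. t * f x) g = t * inn f g"
  by (simp add: l2_inner_def mult.assoc)

lemma inn_scale_right: "inn f (\<lambda>x. t * g x) = cnj t * inn f g"
  by (metis complex_cnj_mult inn_commute inn_scale_left)

lemma inn_self_real: "inn f f = of_real (LINT x|\<sigma>. (cmod (f x))\<^sup>2)"
  unfolding l2_inner_def by (simp only: complex_norm_square[symmetric] integral_complex_of_real)

lemma inn_span_left:
  assumes "f \<in> zw_span S" "continuous_on bicircle g" "\<And>a. a \<in> S \<Longrightarrow> inn (zw_monom a) g = 0"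
  shows "inn f g = 0"
proof -
  obtain c where c: "\<And>x. x \<in> bicircle \<Longrightarrow> f x = (\<Sum>a\<in>S. c a * zw_monom a x)"
    using assms by (auto elim!: zw_spanE)
  have "inn f g = inn (\<lambda>x. \<Sum>a\<in>S. c a * zw_monom a x) g"
    by (rule inn_cong) (simp add: c)
  also have "\<dots> = 0"
    using assms by (subst inn_sum_left) (auto intro: continuous_on_zw_monom)
  finally show ?thesis .
qed

lemma inn_span_right:
  assumes "f \<in> zw_span S" "continuous_on bicircle g" "\<And>a. a \<in> S \<Longrightarrow> inn g (zw_monom a) = 0"
  shows "inn g f = 0"
  using inn_span_left[OF assms(1,2)] assms(3) inn_commute by (metis complex_cnj_zero)

text \<open>Positive definiteness is given on rectangles only; extending \<open>c\<close> by zero to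
  a rectangle around \<open>S\<close> makes its quadratic form both positive and zero.\<close>

lemma moment_kernel_trivial:
  assumes "finite S" "\<And>b. b \<in> S \<Longrightarrow> (\<Sum>a\<in>S. c a * moment_matrix \<sigma> a b) = 0" "a \<in> S"
  shows "c a = 0"
proof (rule ccontr)
  assume "c a \<noteq> 0"
  define R where "R = {0..Max (fst ` S)} \<times> {0..Max (snd ` S)}"
  have R: "S \<subseteq> R" "finite R"
    using assms(1) by (force simp: R_def intro!: Max_ge, simp add: R_def)
  \<comment> \<open>The conjugate is needed because \<open>pos_def_on\<close> conjugates the left
    coefficient, whereas \<open>l2_inner\<close> conjugates its right argument.\<close>
  define d where "d a = (if a \<in> S then cnj (c a) else 0)" for a
  have "pos_def_on R (moment_matrix \<sigma>)"
    using nondegenerate unfolding nondegenerate_bicircle_measure_def R_def by blast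
  moreover have "\<exists>a\<in>R. d a \<noteq> 0"
    using \<open>c a \<noteq> 0\<close> \<open>a \<in> S\<close> R by (auto simp: d_def intro!: bexI[of _ a])
  ultimately have "0 < (\<Sum>a\<in>R. \<Sum>b\<in>R. cnj (d a) * moment_matrix \<sigma> a b * d b)"
    unfolding pos_def_on_def by blast
  also have "\<dots> = (\<Sum>a\<in>S. \<Sum>b\<in>S. c a * moment_matrix \<sigma> a b * cnj (c b))"
    using R by (intro sum.mono_neutral_cong_right) (auto simp: d_def intro!: sum.mono_neutral_cong_right)
  also have "\<dots> = (\<Sum>b\<in>S. (\<Sum>a\<in>S. c a * moment_matrix \<sigma> a b) * cnj (c b))"
    by (subst sum.swap) (simp add: sum_distrib_right)
  also have "\<dots> = 0"
    using assms by simp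
  finally show False
    by simp
qed

text \<open>The coefficients of such an \<open>f\<close> lie in the kernel of the moment matrix on
  \<open>S\<close>.\<close>

lemma span_orthogonal_self_zero:
  assumes "finite S" "f \<in> zw_span S" "\<And>a. a \<in> S \<Longrightarrow> inn f (zw_monom a) = 0" "x \<in> bicircle"
  shows "f x = 0"
proof -
  obtain c where c: "\<And>x. x \<in> bicircle \<Longrightarrow> f x = (\<Sum>a\<in>S. c a * zw_monom a x)"
    using assms by (auto elim!: zw_spanE)
  have "(\<Sum>a\<in>S. c a * moment_matrix \<sigma> a b) = 0" if "b \<in> S" for b
  proof -
    have "0 = inn (\<lambda>x. \<Sum>a\<in>S. c a * zw_monom a x) (zw_monom b)"
      using assms(3)[OF that] by (subst inn_cong[of _ _ f "zw_monom b"]) (auto simp: c)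
    then show ?thesis
      by (subst (asm) inn_sum_left) (auto simp: moment_matrix_def intro: continuous_on_zw_monom)
  qed
  then have "\<forall>a\<in>S. c a = 0"
    using moment_kernel_trivial[OF assms(1), of c] by simp
  then show ?thesis
    using c assms(4) by simp
qed

text \<open>Induction on the index set: adjoining \<open>k\<close> borders the system by one row and
  one column, and the Schur complement \<open>r\<close> of the old block is nonzero because the
  kernel is trivial.\<close>

lemma moment_system_solvable:
  assumes "finite S"
  shows "\<exists>c. \<forall>b\<in>S. (\<Sum>a\<in>S. c a * moment_matrix \<sigma> a b) = h b"
  using assms
proof (induction S arbitrary: h)
  case (insert k S)
  let ?G = "moment_matrix \<sigma>"
  obtain c where c: "\<And>b. b \<in> S \<Longrightarrow> (\<Sum>a\<in>S. c a * ?G a b) = h b"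
    using insert.IH by blast
  obtain d where d: "\<And>b. b \<in> S \<Longrightarrow> (\<Sum>a\<in>S. d a * ?G a b) = ?G k b"
    using insert.IH[of "?G k"] by blast
  \<comment> \<open>These are the coefficients of the monomial \<open>k\<close> minus its projection
    to the span of \<open>S\<close>; they solve the homogeneous equations on
    \<open>S\<close>.\<close>
  define q where "q a = (if a = k then 1 else - d a)" for a
  have sum_q: "(\<Sum>a\<in>insert k S. q a * ?G a b) = ?G k b - (\<Sum>a\<in>S. d a * ?G a b)" for b
  proof -
    have "(\<Sum>a\<in>S. q a * ?G a b) = (\<Sum>a\<in>S. - (d a * ?G a b))"
      using insert by (intro sum.cong) (auto simp: q_def)
    then show ?thesis
      using insert by (simp add: q_def[of k] sum_negf)
  qed
  define r where "r = ?G k k - (\<Sum>a\<in>S. d a * ?G a k)"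
  have "r \<noteq> 0"
  proof
    assume "r = 0"
    then have "(\<Sum>a\<in>insert k S. q a * ?G a b) = 0" if "b \<in> insert k S" for b
      using that d[of b] unfolding sum_q r_def by (cases "b = k") simp_all
    then have "q k = 0"
      using insert by (intro moment_kernel_trivial[of "insert k S" q k]) auto
    then show False
      by (simp add: q_def)
  qed
  \<comment> \<open>Adding \<open>t\<close> times \<open>q\<close> to the old solution
    \<open>c\<close> leaves the equations on \<open>S\<close> intact and corrects the one at
    \<open>k\<close>.\<close>
  define t where "t = (h k - (\<Sum>a\<in>S. c a * ?G a k)) / r"
  define c' where "c' a = (if a = k then t else c a - t * d a)" for a
  have c': "(\<Sum>a\<in>insert k S. c' a * ?G a b) = (\<Sum>a\<in>S. c a * ?G a b) + t * (?G k b - (\<Sum>a\<in>S. d a * ?G a b))" for b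
  proof -
    have "(\<Sum>a\<in>S. c' a * ?G a b) = (\<Sum>a\<in>S. (c a - t * d a) * ?G a b)"
      using insert by (intro sum.cong) (auto simp: c'_def)
    then show ?thesis
      using insert by (simp add: c'_def algebra_simps sum_subtractf sum_distrib_left)
  qed
  have tr: "t * r = h k - (\<Sum>a\<in>S. c a * ?G a k)"
    using \<open>r \<noteq> 0\<close> by (simp add: t_def)
  have "(\<Sum>a\<in>insert k S. c' a * ?G a b) = h b" if "b \<in> insert k S" for b
  proof (cases "b = k")
    case True
    then show ?thesis
      unfolding c' using tr by (simp add: r_def)
  next
    case False
    then show ?thesis
      using that c[of b] d[of b] unfolding c' by simp
  qed
  then show ?case
    by blast
qed simp

section \<open>Existence and uniqueness of the orthonormal polynomials\<close>

text \<open>Gram-Schmidt: \<open>Q\<close> is the monomial \<open>k\<close> minus its projection to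
  the span of \<open>S\<close>, and dividing by its norm keeps the coefficient at \<open>k\<close>
  positive.\<close>

lemma is_orthonormal_poly_exists:
  assumes "finite S" "k \<notin> S"
  shows "\<exists>p. is_orthonormal_poly \<sigma> S k p"
proof -
  let ?T = "insert k S"
  obtain d where d: "\<And>b. b \<in> S \<Longrightarrow> (\<Sum>a\<in>S. d a * moment_matrix \<sigma> a b) = moment_matrix \<sigma> k b"
    using moment_system_solvable[OF assms(1), of "moment_matrix \<sigma> k"] by blast
  define q where "q a = (if a = k then 1 else - d a)" for a
  define Q where "Q = (\<lambda>x. \<Sum>a\<in>?T. q a * zw_monom a x)"
  have Q_inn: "inn Q (zw_monom b) = (\<Sum>a\<in>?T. q a * moment_matrix \<sigma> a b)" for b
    unfolding Q_def moment_matrix_def by (rule inn_sum_left) (auto intro: continuous_on_zw_monom)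
  have Q_S: "inn Q (zw_monom b) = 0" if "b \<in> S" for b
  proof -
    have "(\<Sum>a\<in>S. q a * moment_matrix \<sigma> a b) = (\<Sum>a\<in>S. - (d a * moment_matrix \<sigma> a b))"
      using assms by (intro sum.cong) (auto simp: q_def)
    then show ?thesis
      using assms d[OF that] by (simp add: Q_inn q_def[of k] sum_negf)
  qed
  have "Q \<in> zw_span ?T"
    by (rule zw_spanI[where c = q]) (simp add: Q_def)
  then have Qc: "continuous_on bicircle Q"
    by (rule continuous_on_zw_span)
  \<comment> \<open>Only the monomial \<open>k\<close> of \<open>Q\<close> contributes, since
    \<open>Q\<close> is orthogonal to the others. If the norm vanished, \<open>q\<close> would
    therefore also solve the equation at \<open>k\<close>.\<close>
  have QQ: "inn Q Q = inn Q (zw_monom k)"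
  proof -
    have "(\<lambda>x. \<Sum>a\<in>S. q a * zw_monom a x) \<in> zw_span S"
      by (rule zw_spanI) simp
    then have "inn (\<lambda>x. \<Sum>a\<in>S. q a * zw_monom a x) Q = 0"
    proof (rule inn_span_left[OF _ Qc])
      show "inn (zw_monom b) Q = 0" if "b \<in> S" for b
        using Q_S[OF that] by (metis complex_cnj_zero inn_commute)
    qed
    moreover have "inn Q Q = inn (zw_monom k) Q + inn (\<lambda>x. \<Sum>a\<in>S. q a * zw_monom a x) Q"
    proof -
      have "inn Q Q = (\<Sum>a\<in>?T. q a * inn (zw_monom a) Q)"
        using Qc by (subst (1) Q_def, intro inn_sum_left) (auto intro: continuous_on_zw_monom)
      then show ?thesis
        using assms Qc by (subst inn_sum_left) (auto intro: continuous_on_zw_monom simp: q_def[of k])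
    qed
    ultimately have "inn Q Q = inn (zw_monom k) Q"
      by simp
    then show ?thesis
      using inn_commute by metis
  qed
  define r where "r = (LINT x|\<sigma>. (cmod (Q x))\<^sup>2)"
  have "r \<noteq> 0"
  proof
    assume "r = 0"
    then have "inn Q (zw_monom k) = 0"
      unfolding QQ[symmetric] inn_self_real r_def[symmetric] by simp
    then have "(\<Sum>a\<in>?T. q a * moment_matrix \<sigma> a b) = 0" if "b \<in> ?T" for b
      using that Q_S[of b] unfolding Q_inn[symmetric] by blast
    then have "q k = 0"
      using assms by (intro moment_kernel_trivial[of ?T q k]) auto
    then show False
      by (simp add: q_def)
  qed
  moreover have "r \<ge> 0"
    by (simp add: r_def)
  ultimately have r: "r > 0"
    by simp
  define s where "s = complex_of_real (1 / sqrt r)"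
  let ?p = "bipoly ?T (\<lambda>a. s * q a)"
  have e: "bieval ?p = (\<lambda>x. s * Q x)"
    unfolding bieval_bipoly Q_def by (simp add: sum_distrib_left mult.assoc)
  have "s * (cnj s * inn Q Q) = of_real (1 / sqrt r * (1 / sqrt r * r))"
    unfolding inn_self_real r_def[symmetric] s_def
    by (simp only: complex_cnj_complex_of_real of_real_mult)
  also have "1 / sqrt r * (1 / sqrt r * r) = 1"
    using r by (simp add: field_simps)
  finally have "inn (bieval ?p) (bieval ?p) = 1"
    unfolding e inn_scale_left inn_scale_right by simp
  moreover have "inn (bieval ?p) (zw_monom b) = 0" if "b \<in> S" for b
    unfolding e inn_scale_left using Q_S[OF that] by simp
  moreover have "0 < s"
    using r by (simp add: s_def less_complex_def)
  ultimately have "is_orthonormal_poly \<sigma> S k ?p"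
    using assms unfolding is_orthonormal_poly_def
    by (auto simp: bicoeff_bipoly q_def[of k] split: if_splits)
  then show ?thesis
    by blast
qed

text \<open>Cross-multiplying by the coefficients at \<open>k\<close> cancels that monomial. The
  difference then lies in the span of \<open>S\<close> and is orthogonal to \<open>S\<close>, so it
  vanishes and the polynomials are proportional; norm 1 and positivity fix the factor.\<close>

lemma is_orthonormal_poly_unique:
  assumes "finite S" "k \<notin> S" and p: "is_orthonormal_poly \<sigma> S k p" and q: "is_orthonormal_poly \<sigma> S k q"
  shows "p = q"
proof -
  let ?T = "insert k S"
  define s t where "s = bicoeff p k" and "t = bicoeff q k"
  have st: "0 < s" "0 < t"
    using p q by (auto simp: is_orthonormal_poly_def s_def t_def)
  define r where "r = Polynomial.smult [:t:] p - Polynomial.smult [:s:] q"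
  have r_supp: "a \<in> S" if "bicoeff r a \<noteq> 0" for a
  proof -
    have "a \<noteq> k" "bicoeff p a \<noteq> 0 \<or> bicoeff q a \<noteq> 0"
      using that by (auto simp: r_def bicoeff_diff bicoeff_smult s_def t_def)
    then show ?thesis
      using p q unfolding is_orthonormal_poly_def by blast
  qed
  have span: "bieval p \<in> zw_span ?T" "bieval q \<in> zw_span ?T"
    using assms by (auto intro!: bieval_in_span simp: is_orthonormal_poly_def)
  have r_eval: "bieval r = (\<lambda>x. t * bieval p x - s * bieval q x)"
    by (auto simp: bieval_def r_def)
  have "inn (bieval r) (zw_monom b) = 0" if "b \<in> S" for b
    unfolding r_eval using p q span that
    by (subst inn_diff_left)
      (auto simp: inn_scale_left is_orthonormal_poly_def
        intro!: continuous_on_zw_span zw_span_scale continuous_on_zw_monom)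
  moreover have "inn (bieval r) (zw_monom b) = (\<Sum>a\<in>S. bicoeff r a * moment_matrix \<sigma> a b)" for b
    using r_supp assms
    by (subst bieval_eq_sum_bicoeff[of S]) (auto simp: moment_matrix_def inn_sum_left continuous_on_zw_monom)
  ultimately have "bicoeff r a = 0" if "a \<in> S" for a
    using moment_kernel_trivial[OF assms(1), of "bicoeff r"] that by simp
  then have "bicoeff r a = 0" for a
    using r_supp by blast
  then have eq: "t * bicoeff p a = s * bicoeff q a" for a
    by (simp add: r_def bicoeff_diff bicoeff_smult)
  then have "Polynomial.smult [:t:] p = Polynomial.smult [:s:] q"
    by (intro bipoly_eqI) (simp add: bicoeff_smult)
  then have "(\<lambda>x. t * bieval p x) = (\<lambda>x. s * bieval q x)"
    unfolding bieval_smult[symmetric] by simp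
  then have "inn (\<lambda>x. t * bieval p x) (\<lambda>x. t * bieval p x) = inn (\<lambda>x. s * bieval q x) (\<lambda>x. s * bieval q x)"
    by simp
  then have "t * cnj t = s * cnj s"
    using p q by (simp add: inn_scale_left inn_scale_right is_orthonormal_poly_def)
  then have "s = t"
  proof -
    \<comment> \<open>Positivity in the order on \<open>complex\<close> includes being real, so
      equal squared moduli force equality.\<close>
    have "s = of_real (Re s)" "t = of_real (Re t)" "Re s > 0" "Re t > 0"
      using st by (auto simp: less_complex_def complex_eq_iff)
    moreover from this have "complex_of_real ((Re t)\<^sup>2) = complex_of_real ((Re s)\<^sup>2)"
      using \<open>t * cnj t = s * cnj s\<close> by (metis complex_cnj_complex_of_real of_real_mult power2_eq_square)
    ultimately show ?thesis
      by (metis of_real_eq_iff power2_eq_iff_nonneg less_imp_le)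
  qed
  with eq st show ?thesis
    by (intro bipoly_eqI) auto
qed

lemma is_orthonormal_poly_the:
  assumes "finite S" "k \<notin> S"
  shows "is_orthonormal_poly \<sigma> S k (THE p. is_orthonormal_poly \<sigma> S k p)"
  using is_orthonormal_poly_exists[OF assms] is_orthonormal_poly_unique[OF assms] by (auto intro: theI)


section \<open>Orthonormal bases of relative orthogonal complements\<close>

text \<open>\<open>E\<close> represents an orthonormal basis of the orthogonal complement of \<open>zw_span S\<close> in \<open>zw_span T\<close>;
  only the resulting expansion property is recorded.\<close>

definition onb_mod :: "(nat \<times> nat) set \<Rightarrow> (nat \<times> nat) set \<Rightarrow> fvec \<Rightarrow> bool" where
  "onb_mod T S E \<longleftrightarrow>
     (\<forall>i<dim_vec E. E $ i \<in> zw_span T \<and> (\<forall>a\<in>S. inn (E $ i) (zw_monom a) = 0)) \<and>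
     (\<forall>f\<in>zw_span T. (\<lambda>x. f x - (\<Sum>i<dim_vec E. inn f (E $ i) * (E $ i) x)) \<in> zw_span S)"

lemma onb_mod_in_span: "onb_mod T S E \<Longrightarrow> i < dim_vec E \<Longrightarrow> E $ i \<in> zw_span T"
  by (auto simp: onb_mod_def)

lemma onb_mod_continuous: "onb_mod T S E \<Longrightarrow> i < dim_vec E \<Longrightarrow> continuous_on bicircle (E $ i)"
  by (metis onb_mod_in_span continuous_on_zw_span)

lemma onb_mod_orthogonal: "onb_mod T S E \<Longrightarrow> i < dim_vec E \<Longrightarrow> a \<in> S \<Longrightarrow> inn (E $ i) (zw_monom a) = 0"
  by (auto simp: onb_mod_def)

lemma onb_mod_remainder:
  "onb_mod T S E \<Longrightarrow> f \<in> zw_span T \<Longrightarrow>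
     (\<lambda>x. f x - (\<Sum>i<dim_vec E. inn f (E $ i) * (E $ i) x)) \<in> zw_span S"
  by (auto simp: onb_mod_def)

lemma inn_diff_sum_left:
  assumes "continuous_on bicircle f" "continuous_on bicircle g"
    and "\<And>i. i \<in> I \<Longrightarrow> continuous_on bicircle (e i)"
  shows "inn (\<lambda>x. f x - (\<Sum>i\<in>I. c i * e i x)) g = inn f g - (\<Sum>i\<in>I. c i * inn (e i) g)"
  using assms by (subst inn_diff_left) (auto simp: inn_sum_left intro!: continuous_intros)

text \<open>The family is triangular with respect to the order \<open>k 0\<close>,
  \<open>k 1\<close>, and so on. Elimination from the top gives some expansion modulo
  \<open>zw_span S\<close>, and orthonormality identifies its coefficients. The vector runs from the
  highest index down, as in \<open>Phi\<close>.\<close>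

lemma onb_mod_orthonormal_polys:
  assumes "finite S" "inj_on k {..<d}" "k ` {..<d} \<inter> S = {}"
    and p: "\<And>l. l < d \<Longrightarrow> is_orthonormal_poly \<sigma> (S \<union> k ` {..<l}) (k l) (p l)"
  shows "onb_mod (S \<union> k ` {..<d}) S (vec d (\<lambda>i. bieval (p (d - Suc i))))"
proof -
  define e where "e l = bieval (p l)" for l
  have fin: "finite (S \<union> k ` {..<l})" for l
    using assms by simp
  have ins: "S \<union> k ` {..<Suc l} = insert (k l) (S \<union> k ` {..<l})" for l
    by (auto simp: lessThan_Suc)
  have span: "e l \<in> zw_span (S \<union> k ` {..<Suc l})" if "l < d" for l
    unfolding e_def ins using p[OF that] fin
    by (intro bieval_in_span) (auto simp: is_orthonormal_poly_def)
  have span': "e l \<in> zw_span (S \<union> k ` {..<l'})" if "l < l'" "l' \<le> d" for l l'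
    using that fin by (intro zw_span_mono[OF span]) auto
  have cont: "continuous_on bicircle (e l)" if "l < d" for l
    using span[OF that] by (rule continuous_on_zw_span)
  have orth: "inn (e l) (zw_monom a) = 0" if "l < d" "a \<in> S \<union> k ` {..<l}" for l a
    using p[OF that(1)] that(2) by (simp add: e_def is_orthonormal_poly_def)
  have e_less: "inn (e l) (e l') = 0" if "l' < l" "l < d" for l l'
    using that span' cont orth by (intro inn_span_right[of "e l'" "S \<union> k ` {..<l}"]) auto
  have e_inn: "inn (e l) (e l') = (if l = l' then 1 else 0)" if "l < d" "l' < d" for l l'
  proof (cases l l' rule: linorder_cases)
    case less
    then show ?thesis
      using e_less[OF less that(2)] inn_commute[of "e l'" "e l"] by simp
  next
    case equal
    then show ?thesis
      using p[OF that(1)] by (simp add: e_def is_orthonormal_poly_def)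
  next
    case greater
    then show ?thesis
      using e_less[OF greater that(1)] by simp
  qed
  \<comment> \<open>Only the existence of coefficients is shown here; \<open>remainder\<close>
    identifies them as inner products.\<close>
  have decomp: "\<exists>c. (\<lambda>x. f x - (\<Sum>i<l. c i * e i x)) \<in> zw_span S"
    if "l \<le> d" "f \<in> zw_span (S \<union> k ` {..<l})" for l f
    using that
  proof (induction l arbitrary: f)
    case (Suc l)
    have nin: "k l \<notin> S \<union> k ` {..<l}"
    proof
      assume "k l \<in> S \<union> k ` {..<l}"
      moreover have "k l \<notin> S"
        using Suc.prems(1) assms(3) by (metis Suc_le_lessD disjoint_iff imageI lessThan_iff)
      ultimately obtain l' where "l' < l" "k l = k l'"
        by auto
      then show False
        using Suc.prems(1) inj_onD[OF assms(2), of l l'] by simp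
    qed
    have orthonormal: "is_orthonormal_poly \<sigma> (S \<union> k ` {..<l}) (k l) (p l)"
      using p Suc.prems(1) by simp
    have pl: "a \<in> insert (k l) (S \<union> k ` {..<l})" if "bicoeff (p l) a \<noteq> 0" for a
      using orthonormal that unfolding is_orthonormal_poly_def by blast
    have pk: "bicoeff (p l) (k l) \<noteq> 0"
      using orthonormal by (auto simp: is_orthonormal_poly_def)
    obtain t where "(\<lambda>x. f x - t * e l x) \<in> zw_span (S \<union> k ` {..<l})"
      unfolding e_def
      using zw_span_cancel_leading[OF Suc.prems(2)[unfolded ins] fin nin pl pk] by blast
    then obtain c where "(\<lambda>x. (f x - t * e l x) - (\<Sum>i<l. c i * e i x)) \<in> zw_span S"
      using Suc.IH[of "\<lambda>x. f x - t * e l x"] Suc.prems by auto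
    moreover have "(\<Sum>i<Suc l. (c(l := t)) i * e i x) = t * e l x + (\<Sum>i<l. c i * e i x)" for x
      by simp
    ultimately have "(\<lambda>x. f x - (\<Sum>i<Suc l. (c(l := t)) i * e i x)) \<in> zw_span S"
      by (simp only: diff_diff_eq)
    then show ?case
      by blast
  qed auto
  have remainder: "(\<lambda>x. f x - (\<Sum>i<d. inn f (e i) * e i x)) \<in> zw_span S"
    if f: "f \<in> zw_span (S \<union> k ` {..<d})" for f
  proof -
    obtain c where c: "(\<lambda>x. f x - (\<Sum>i<d. c i * e i x)) \<in> zw_span S"
      using decomp[OF _ f] by auto
    \<comment> \<open>The remainder lies in \<open>zw_span S\<close>, to which \<open>e j\<close> is
      orthogonal, so pairing with \<open>e j\<close> isolates \<open>c j\<close>.\<close>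
    have "inn f (e j) = c j" if "j < d" for j
    proof -
      have "inn (zw_monom a) (e j) = 0" if "a \<in> S" for a
        using orth[OF \<open>j < d\<close>, of a] that inn_commute[of "e j" "zw_monom a"] by simp
      then have "0 = inn (\<lambda>x. f x - (\<Sum>i<d. c i * e i x)) (e j)"
        using inn_span_left[OF c cont[OF that]] by simp
      also have "\<dots> = inn f (e j) - (\<Sum>i<d. c i * inn (e i) (e j))"
        using cont that continuous_on_zw_span[OF f] by (intro inn_diff_sum_left) auto
      also have "(\<Sum>i<d. c i * inn (e i) (e j)) = (\<Sum>i<d. if i = j then c i else 0)"
        using that by (intro sum.cong) (auto simp: e_inn)
      finally show ?thesis
        using that by simp
    qed
    then show ?thesis
      using c by simp
  qed
  have reindex: "(\<Sum>i<d. h (d - Suc i)) = (\<Sum>i<d. h i)" for h :: "nat \<Rightarrow> complex"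
    by (rule sum.nat_diff_reindex)
  show ?thesis
    unfolding onb_mod_def
  proof (intro conjI allI impI ballI)
    fix i a
    assume i: "i < dim_vec (vec d (\<lambda>i. bieval (p (d - Suc i))))"
    then show "vec d (\<lambda>i. bieval (p (d - Suc i))) $ i \<in> zw_span (S \<union> k ` {..<d})"
      using span'[of "d - Suc i" d] by (simp add: e_def)
    show "inn (vec d (\<lambda>i. bieval (p (d - Suc i))) $ i) (zw_monom a) = 0" if "a \<in> S"
      using i that orth[of "d - Suc i" a] by (simp add: e_def)
  next
    fix f
    assume "f \<in> zw_span (S \<union> k ` {..<d})"
    from remainder[OF this]
    show "(\<lambda>x. f x - (\<Sum>i<dim_vec (vec d (\<lambda>i. bieval (p (d - Suc i)))).
        inn f (vec d (\<lambda>i. bieval (p (d - Suc i))) $ i) * (vec d (\<lambda>i. bieval (p (d - Suc i))) $ i) x))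
          \<in> zw_span S"
      using reindex[of "\<lambda>i. inn f (bieval (p i)) * bieval (p i) x" for x] by (simp add: e_def)
  qed
qed

lemma onb_mod_Phi:
  "onb_mod ({..<Suc n} \<times> {..<Suc m}) ({..<n} \<times> {..<Suc m}) (Phi \<sigma> n m)"
proof -
  let ?S = "{..<n} \<times> {..<Suc m}"
  \<comment> \<open>The exponents below \<open>(n, l)\<close> are the rectangle \<open>?S\<close>
    followed by the first \<open>l\<close> points of the new column, which is the triangular shape
    required.\<close>
  have S: "{(i, j). i < n \<and> j \<le> m \<or> i = n \<and> j < l} = ?S \<union> Pair n ` {..<l}" for l
    by auto
  have "onb_mod (?S \<union> Pair n ` {..<Suc m}) ?S (vec (Suc m) (\<lambda>i. bieval (phi \<sigma> n m (Suc m - Suc i))))"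
    by (rule onb_mod_orthonormal_polys)
      (auto simp: inj_on_def phi_def S intro!: is_orthonormal_poly_the)
  moreover have "?S \<union> Pair n ` {..<Suc m} = {..<Suc n} \<times> {..<Suc m}"
    by auto
  ultimately show ?thesis
    by (simp add: Phi_def)
qed

lemma onb_mod_Phi_tilde:
  "onb_mod ({..<Suc n} \<times> {..<Suc m}) ({..<Suc n} \<times> {..<m}) (Phi_tilde \<sigma> n m)"
proof -
  let ?S = "{..<Suc n} \<times> {..<m}"
  have S: "{(i, j). j < m \<and> i \<le> n \<or> j = m \<and> i < l} = ?S \<union> (\<lambda>i. (i, m)) ` {..<l}" for l
    by auto
  have "onb_mod (?S \<union> (\<lambda>i. (i, m)) ` {..<Suc n}) ?S
      (vec (Suc n) (\<lambda>i. bieval (phi_tilde \<sigma> n m (Suc n - Suc i))))"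
    by (rule onb_mod_orthonormal_polys)
      (auto simp: inj_on_def phi_tilde_def S intro!: is_orthonormal_poly_the)
  moreover have "?S \<union> (\<lambda>i. (i, m)) ` {..<Suc n} = {..<Suc n} \<times> {..<Suc m}"
    by auto
  ultimately show ?thesis
    by (simp add: Phi_tilde_def)
qed

text \<open>The complement is trivial when both sets agree; this covers the empty families at index
  0.\<close>

lemma onb_mod_vNil: "onb_mod S S vNil"
  by (simp add: onb_mod_def)

text \<open>The remainder of \<open>f\<close> lies in \<open>zw_span S\<close>, and \<open>g\<close>
  is orthogonal to it.\<close>

lemma inn_eq_sum_onb:
  assumes E: "onb_mod T S E" and f: "f \<in> zw_span T" and g: "continuous_on bicircle g"
    and orth: "\<And>a. a \<in> S \<Longrightarrow> inn g (zw_monom a) = 0"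
  shows "inn f g = (\<Sum>i<dim_vec E. inn f (E $ i) * inn (E $ i) g)"
proof -
  have "inn (zw_monom a) g = 0" if "a \<in> S" for a
    using orth[OF that] inn_commute[of g "zw_monom a"] by simp
  then have "0 = inn (\<lambda>x. f x - (\<Sum>i<dim_vec E. inn f (E $ i) * (E $ i) x)) g"
    using inn_span_left[OF onb_mod_remainder[OF E f] g] by simp
  also have "\<dots> = inn f g - (\<Sum>i<dim_vec E. inn f (E $ i) * inn (E $ i) g)"
    using f g E by (intro inn_diff_sum_left) (auto intro: continuous_on_zw_span onb_mod_continuous)
  finally show ?thesis
    by simp
qed

text \<open>Here the orthogonality is on the side of \<open>f\<close>: the remainder lies in
  \<open>zw_span S\<close> and is orthogonal to \<open>S\<close>, so it vanishes on the bi-circle,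
  and \<open>g\<close> may be any continuous function.\<close>

lemma inn_eq_sum_onb_orthogonal:
  assumes E: "onb_mod T S E" and S: "finite S" and f: "f \<in> zw_span T" and g: "continuous_on bicircle g"
    and orth: "\<And>a. a \<in> S \<Longrightarrow> inn f (zw_monom a) = 0"
  shows "inn f g = (\<Sum>i<dim_vec E. inn f (E $ i) * inn (E $ i) g)"
proof -
  let ?r = "\<lambda>x. f x - (\<Sum>i<dim_vec E. inn f (E $ i) * (E $ i) x)"
  have r_inn: "inn ?r h = inn f h - (\<Sum>i<dim_vec E. inn f (E $ i) * inn (E $ i) h)"
    if "continuous_on bicircle h" for h
    using f that E by (intro inn_diff_sum_left) (auto intro: continuous_on_zw_span onb_mod_continuous)
  have "inn ?r (zw_monom a) = 0" if "a \<in> S" for a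
    using that orth onb_mod_orthogonal[OF E]
    by (subst r_inn) (auto intro: continuous_on_zw_monom)
  then have "?r x = 0" if "x \<in> bicircle" for x
    using span_orthogonal_self_zero[OF S onb_mod_remainder[OF E f]] that by blast
  then have "inn ?r g = inn (\<lambda>_. 0) g"
    by (intro inn_cong) (simp only:)
  then show ?thesis
    using r_inn[OF g] by (simp add: l2_inner_def)
qed

section \<open>Products of matrices of inner products\<close>

lemma dim_ip [simp]: "dim_row (ip \<sigma> X Y) = dim_vec X" "dim_col (ip \<sigma> X Y) = dim_vec Y"
  by (simp_all add: ip_def)

lemma ip_index: "i < dim_vec X \<Longrightarrow> j < dim_vec Y \<Longrightarrow> ip \<sigma> X Y $$ (i, j) = inn (X $ i) (Y $ j)"
  by (simp add: ip_def)

lemma ip_mult_index: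
  assumes "i < dim_vec X" "j < dim_vec Z" "dim_vec Y' = dim_vec Y"
  shows "(ip \<sigma> X Y * ip \<sigma> Y' Z) $$ (i, j) = (\<Sum>k<dim_vec Y. inn (X $ i) (Y $ k) * inn (Y' $ k) (Z $ j))"
  using assms by (simp add: scalar_prod_def ip_index atLeast0LessThan)

text \<open>Parseval's identity in matrix form: \<open>F\<close> may be replaced by its projection
  along \<open>E\<close>, because the remainder is orthogonal to \<open>G\<close>.\<close>

lemma ip_mult_onb:
  assumes "onb_mod T S E"
    and "\<And>i. i < dim_vec F \<Longrightarrow> F $ i \<in> zw_span T"
    and "onb_mod T' S G"
  shows "ip \<sigma> F E * ip \<sigma> E G = ip \<sigma> F G"
proof (rule eq_matI)
  fix i j
  assume "i < dim_row (ip \<sigma> F G)" "j < dim_col (ip \<sigma> F G)"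
  then have ij: "i < dim_vec F" "j < dim_vec G"
    by simp_all
  show "(ip \<sigma> F E * ip \<sigma> E G) $$ (i, j) = ip \<sigma> F G $$ (i, j)"
    unfolding ip_mult_index[OF ij refl] ip_index[OF ij]
    using inn_eq_sum_onb[OF assms(1) assms(2)[OF ij(1)] onb_mod_continuous[OF assms(3) ij(2)]]
      onb_mod_orthogonal[OF assms(3) ij(2)] by simp
qed simp_all

section \<open>Reversal on the bi-circle\<close>

lemma bicircle_cnj: "x \<in> bicircle \<Longrightarrow> fst x * cnj (fst x) = 1" "x \<in> bicircle \<Longrightarrow> snd x * cnj (snd x) = 1"
  by (auto simp: bicircle_def simp flip: complex_norm_square)

lemma bicircle_inverse: "x \<in> bicircle \<Longrightarrow> (1 / cnj (fst x), 1 / cnj (snd x)) = x"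
  using bicircle_cnj[of x] by (cases x) (auto simp: field_simps divide_eq_eq)

lemma rev_fun_bicircle:
  "x \<in> bicircle \<Longrightarrow> rev_fun n m f x = fst x ^ n * snd x ^ m * cnj (f x)"
  using bicircle_inverse[of x] by (cases x) (simp add: rev_fun_def)

lemma bicircle_monom_cnj:
  assumes "x \<in> bicircle"
  shows "(fst x ^ n * snd x ^ m) * cnj (fst x ^ n * snd x ^ m) = 1"
proof -
  have "(fst x ^ n * snd x ^ m) * cnj (fst x ^ n * snd x ^ m)
      = (fst x * cnj (fst x)) ^ n * (snd x * cnj (snd x)) ^ m"
    by (simp add: power_mult_distrib)
  then show ?thesis
    using bicircle_cnj[OF assms] by simp
qed

text \<open>On the bi-circle, reversal is conjugation followed by multiplication by a unimodular
  monomial; hence it is antiunitary and exchanges the two arguments.\<close>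

lemma inn_rev_fun: "inn (rev_fun n m f) (rev_fun n m g) = inn g f"
proof (rule inn_cong)
  fix x
  assume x: "x \<in> bicircle"
  let ?u = "fst x ^ n * snd x ^ m"
  have "rev_fun n m f x * cnj (rev_fun n m g x) = (?u * cnj ?u) * (g x * cnj (f x))"
    using x by (simp add: rev_fun_bicircle)
  then show "rev_fun n m f x * cnj (rev_fun n m g x) = g x * cnj (f x)"
    unfolding bicircle_monom_cnj[OF x] by simp
qed

lemma rev_fun_rev_fun:
  assumes x: "x \<in> bicircle"
  shows "rev_fun n m (rev_fun n m f) x = f x"
proof -
  let ?u = "fst x ^ n * snd x ^ m"
  have "rev_fun n m (rev_fun n m f) x = (?u * cnj ?u) * f x"
    using x by (simp add: rev_fun_bicircle)
  then show ?thesis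
    unfolding bicircle_monom_cnj[OF x] by simp
qed

text \<open>Reversal is an antiunitary involution, so it moves across the inner product with an
  exchange of the arguments.\<close>

lemma inn_rev_fun_left: "inn (rev_fun n m f) g = inn (rev_fun n m g) f"
proof -
  have "inn (rev_fun n m f) g = inn (rev_fun n m f) (rev_fun n m (rev_fun n m g))"
    by (rule inn_cong) (simp add: rev_fun_rev_fun)
  then show ?thesis
    by (simp add: inn_rev_fun)
qed

lemma inn_rev_fun_right: "inn f (rev_fun n m g) = inn g (rev_fun n m f)"
  using inn_rev_fun_left[of n m g f] inn_commute by metis

lemma rev_fun_monom:
  assumes "x \<in> bicircle" "i \<le> n" "j \<le> m"
  shows "rev_fun n m (zw_monom (i, j)) x = zw_monom (n - i, m - j) x"
proof -
  obtain a b where n: "n = i + a" and m: "m = j + b"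
    using assms(2,3) by (auto simp: le_iff_add)
  let ?u = "fst x ^ i * snd x ^ j"
  have "rev_fun n m (zw_monom (i, j)) x = (?u * cnj ?u) * (fst x ^ a * snd x ^ b)"
    using assms(1) by (simp add: rev_fun_bicircle zw_monom_def case_prod_beta n m power_add)
  then show ?thesis
    unfolding bicircle_monom_cnj[OF assms(1)] by (simp add: zw_monom_def case_prod_beta n m)
qed

lemma continuous_on_rev_fun:
  "continuous_on bicircle f \<Longrightarrow> continuous_on bicircle (rev_fun n m f)"
  by (subst continuous_on_cong[OF refl rev_fun_bicircle]) (auto intro!: continuous_intros)

lemma rev_fun_in_span:
  assumes "f \<in> zw_span ({..<Suc n} \<times> {..<Suc m})"
  shows "rev_fun n m f \<in> zw_span ({..<Suc n} \<times> {..<Suc m})"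
proof -
  let ?D = "{..<Suc n} \<times> {..<Suc m}"
  obtain c where c: "\<And>x. x \<in> bicircle \<Longrightarrow> f x = (\<Sum>a\<in>?D. c a * zw_monom a x)"
    using assms by (auto elim!: zw_spanE)
  have eq: "rev_fun n m f x = (\<Sum>a\<in>?D. cnj (c a) * zw_monom (n - fst a, m - snd a) x)" if "x \<in> bicircle" for x
  proof -
    have "rev_fun n m f x = (\<Sum>a\<in>?D. cnj (c a) * rev_fun n m (zw_monom a) x)"
      using that by (simp add: rev_fun_bicircle c cnj_sum sum_distrib_left mult_ac)
    also have "\<dots> = (\<Sum>a\<in>?D. cnj (c a) * zw_monom (n - fst a, m - snd a) x)"
      using that by (intro sum.cong) (auto simp: rev_fun_monom)
    finally show ?thesis .
  qed
  have "(\<lambda>x. \<Sum>a\<in>?D. cnj (c a) * zw_monom (n - fst a, m - snd a) x) \<in> zw_span ?D"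
    by (intro zw_span_sum zw_span_scale zw_monom_in_span) auto
  then show ?thesis
    using eq unfolding zw_span_def by simp
qed

text \<open>Parseval's identity for the reversed basis, obtained by reversing both factors and
  expanding the reverse of \<open>G\<close> along \<open>E\<close>. Since \<open>G\<close> is the
  factor expanded, \<open>F\<close> need not lie in the span, as is the case for \<open>z\<close>
  times a polynomial of full degree.\<close>

lemma ip_mult_rev_onb:
  assumes E: "onb_mod T S E"
    and F: "\<And>i. i < dim_vec F \<Longrightarrow> continuous_on bicircle (F $ i)"
    and orth: "\<And>i a. i < dim_vec F \<Longrightarrow> a \<in> S \<Longrightarrow> inn (F $ i) (rev_fun n m (zw_monom a)) = 0"
    and G: "\<And>j. j < dim_vec G \<Longrightarrow> rev_fun n m (G $ j) \<in> zw_span T"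
  shows "ip \<sigma> F (map_vec (rev_fun n m) E) * ip \<sigma> (map_vec (rev_fun n m) E) G = ip \<sigma> F G"
proof (rule eq_matI)
  let ?R = "rev_fun n m"
  fix i j
  assume "i < dim_row (ip \<sigma> F G)" "j < dim_col (ip \<sigma> F G)"
  then have ij: "i < dim_vec F" "j < dim_vec G"
    by simp_all
  have "inn (F $ i) (G $ j) = inn (?R (G $ j)) (?R (F $ i))"
    by (simp add: inn_rev_fun)
  also have "\<dots> = (\<Sum>k<dim_vec E. inn (?R (G $ j)) (E $ k) * inn (E $ k) (?R (F $ i)))"
  proof (rule inn_eq_sum_onb[OF E G[OF ij(2)] continuous_on_rev_fun[OF F[OF ij(1)]]])
    show "inn (?R (F $ i)) (zw_monom a) = 0" if "a \<in> S" for a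
      using orth[OF ij(1) that] inn_commute[of "F $ i" "?R (zw_monom a)"]
      by (simp add: inn_rev_fun_left[of _ _ "F $ i"])
  qed
  also have "\<dots> = (\<Sum>k<dim_vec E. inn (F $ i) (?R (E $ k)) * inn (?R (E $ k)) (G $ j))"
    by (intro sum.cong refl)
      (simp add: inn_rev_fun_left[of _ _ "G $ j"] inn_rev_fun_right[of _ _ _ "F $ i"])
  finally show "(ip \<sigma> F (map_vec ?R E) * ip \<sigma> (map_vec ?R E) G) $$ (i, j) = ip \<sigma> F G $$ (i, j)"
    using ij by (subst ip_mult_index) (auto simp: ip_index)
qed simp_all

section \<open>The identity for a general multiplier and general bases\<close>

text \<open>A common form of \<open>zmul\<close> and \<open>wmul\<close>, which lets one argument
  serve both identities.\<close>

definition umul :: "(complex \<times> complex \<Rightarrow> complex) \<Rightarrow> fvec \<Rightarrow> fvec" where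
  "umul u = map_vec (\<lambda>f x. u x * f x)"

lemma zmul_eq_umul: "zmul = umul fst" and wmul_eq_umul: "wmul = umul snd"
  by (simp_all add: zmul_def wmul_def umul_def case_prod_beta')

lemma dim_umul [simp]: "dim_vec (umul u X) = dim_vec X"
  by (simp add: umul_def)

lemma umul_index [simp]: "i < dim_vec X \<Longrightarrow> umul u X $ i = (\<lambda>x. u x * (X $ i) x)"
  by (simp add: umul_def)

text \<open>Each entry of \<open>P\<close> is its projection along \<open>Q\<close> plus a remainder
  in the span of \<open>C\<close>. The remainder is still orthogonal to \<open>A\<close>, so it is
  its own expansion along \<open>T'\<close>, with the coefficients that the entry of
  \<open>P\<close> itself has.\<close>

lemma ip_split_umul:
  assumes A: "finite A" "A \<subseteq> C" and B: "finite D" "B \<subseteq> D"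
    and u: "continuous_on bicircle u"
    and P: "onb_mod B A P" and Q: "onb_mod D C Q" and T: "onb_mod D B T" and T': "onb_mod C A T'"
  shows "ip \<sigma> P Q * ip \<sigma> (umul u Q) T + ip \<sigma> P T' * ip \<sigma> (umul u T') T = ip \<sigma> (umul u P) T"
proof (rule eq_matI)
  fix i j
  assume "i < dim_row (ip \<sigma> (umul u P) T)" "j < dim_col (ip \<sigma> (umul u P) T)"
  then have ij: "i < dim_vec P" "j < dim_vec T"
    by simp_all
  \<comment> \<open>The multiplier passes to the right argument as its conjugate. The result
    \<open>g\<close> is only known to be continuous, which is all that the expansions of the left
    argument ask of it.\<close>
  define f g where "f = P $ i" and "g = (\<lambda>x. cnj (u x) * (T $ j) x)"
  have inn_u: "inn (\<lambda>x. u x * h x) (T $ j) = inn h g" for h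
    by (rule inn_cong) (simp add: g_def)
  have g: "continuous_on bicircle g"
    unfolding g_def by (intro continuous_intros u onb_mod_continuous[OF T ij(2)])
  have f: "f \<in> zw_span D"
    unfolding f_def using zw_span_mono[OF onb_mod_in_span[OF P ij(1)]] B by blast
  define r where "r = (\<lambda>x. f x - (\<Sum>k<dim_vec Q. inn f (Q $ k) * (Q $ k) x))"
  have r: "r \<in> zw_span C"
    unfolding r_def by (rule onb_mod_remainder[OF Q f])
  have r_inn: "inn r h = inn f h - (\<Sum>k<dim_vec Q. inn f (Q $ k) * inn (Q $ k) h)"
    if "continuous_on bicircle h" for h
    unfolding r_def using that f Q
    by (intro inn_diff_sum_left) (auto intro: continuous_on_zw_span onb_mod_continuous)
  have r_A: "inn r (zw_monom a) = 0" if "a \<in> A" for a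
  proof -
    have "a \<in> C"
      using that A(2) by blast
    then show ?thesis
      using onb_mod_orthogonal[OF Q] onb_mod_orthogonal[OF P ij(1) that]
      by (simp add: r_inn continuous_on_zw_monom f_def)
  qed
  \<comment> \<open>The entries of \<open>T'\<close> lie in the span of \<open>C\<close>, to which
    \<open>Q\<close> is orthogonal, so subtracting the projection along \<open>Q\<close> does not
    change these coefficients.\<close>
  have r_T': "inn r (T' $ k) = inn f (T' $ k)" if "k < dim_vec T'" for k
  proof -
    have "inn (Q $ l) (T' $ k) = 0" if "l < dim_vec Q" for l
      using inn_span_right[OF onb_mod_in_span[OF T' \<open>k < dim_vec T'\<close>] onb_mod_continuous[OF Q that]]
        onb_mod_orthogonal[OF Q that] by simp
    then show ?thesis
      using onb_mod_continuous[OF T' that] by (simp add: r_inn)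
  qed
  have "inn f g = (\<Sum>k<dim_vec Q. inn f (Q $ k) * inn (Q $ k) g) + inn r g"
    using r_inn[OF g] by simp
  also have "inn r g = (\<Sum>k<dim_vec T'. inn f (T' $ k) * inn (T' $ k) g)"
    using inn_eq_sum_onb_orthogonal[OF T' A(1) r g r_A] by (simp add: r_T')
  finally show "(ip \<sigma> P Q * ip \<sigma> (umul u Q) T + ip \<sigma> P T' * ip \<sigma> (umul u T') T) $$ (i, j)
      = ip \<sigma> (umul u P) T $$ (i, j)"
    using ij by (simp add: ip_mult_index ip_index inn_u f_def del: index_mult_mat(1))
qed simp_all

text \<open>With \<open>u = z\<close> this is the first identity. With \<open>u = w\<close> and the roles of \<open>\<Phi>\<close> and \<open>\<Phi>~\<close> interchanged
  it is the second, so that no transfer along the swap of the variables is needed.\<close>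

lemma Gamma_E_hat_I1_generic:
  assumes "finite A" "A \<subseteq> C" "finite D" "B \<subseteq> D"
    and u: "continuous_on bicircle u" "\<And>x. x \<in> bicircle \<Longrightarrow> u x * cnj (u x) = 1"
    and P: "onb_mod B A P" and Q: "onb_mod D C Q" and P': "onb_mod B' B P'"
    and T: "onb_mod D B T" and T': "onb_mod C A T'"
    and shift: "\<And>f. f \<in> zw_span B \<Longrightarrow> (\<lambda>x. u x * f x) \<in> zw_span B'"
    and rev_D: "\<And>f. f \<in> zw_span D \<Longrightarrow> rev_fun n m f \<in> zw_span D"
    and rev_C: "\<And>a. a \<in> C \<Longrightarrow>
      \<exists>b\<in>C. \<forall>x\<in>bicircle. rev_fun n m (zw_monom a) x = u x * zw_monom b x"
  shows "ip \<sigma> P Q * ip \<sigma> (umul u Q) (map_vec (rev_fun n m) Q) * ip \<sigma> (map_vec (rev_fun n m) Q) T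
      = ip \<sigma> (umul u P) P' * ip \<sigma> P' T - ip \<sigma> P T' * ip \<sigma> (umul u T') T"
proof -
  let ?R = "map_vec (rev_fun n m) Q"
  have inn_u: "inn (\<lambda>x. u x * f x) (\<lambda>x. u x * g x) = inn f g" for f g
  proof (rule inn_cong)
    fix x
    assume "x \<in> bicircle"
    have "u x * f x * cnj (u x * g x) = (u x * cnj (u x)) * (f x * cnj (g x))"
      by simp
    then show "u x * f x * cnj (u x * g x) = f x * cnj (g x)"
      using u(2)[OF \<open>x \<in> bicircle\<close>] by simp
  qed
  have "ip \<sigma> (umul u Q) ?R * ip \<sigma> ?R T = ip \<sigma> (umul u Q) T"
  proof (rule ip_mult_rev_onb[OF Q])
    show "continuous_on bicircle (umul u Q $ i)" if "i < dim_vec (umul u Q)" for i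
      using that u(1) onb_mod_continuous[OF Q] by (auto intro!: continuous_intros)
    \<comment> \<open>A reversed monomial from \<open>C\<close> has a factor \<open>u\<close>. It
      cancels against the one on \<open>Q\<close> because \<open>u\<close> is unimodular, and what
      remains is the orthogonality of \<open>Q\<close> to \<open>C\<close>.\<close>
    show "inn (umul u Q $ i) (rev_fun n m (zw_monom a)) = 0" if i: "i < dim_vec (umul u Q)" and "a \<in> C" for i a
    proof -
      obtain b where b: "b \<in> C" "\<And>x. x \<in> bicircle \<Longrightarrow> rev_fun n m (zw_monom a) x = u x * zw_monom b x"
        using rev_C[OF \<open>a \<in> C\<close>] by blast
      have "inn (umul u Q $ i) (rev_fun n m (zw_monom a)) = inn (\<lambda>x. u x * (Q $ i) x) (\<lambda>x. u x * zw_monom b x)"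
        using i b(2) by (intro inn_cong) simp
      also have "\<dots> = 0"
        using i b(1) onb_mod_orthogonal[OF Q] by (simp add: inn_u)
      finally show ?thesis .
    qed
    show "rev_fun n m (T $ j) \<in> zw_span D" if "j < dim_vec T" for j
      by (intro rev_D onb_mod_in_span[OF T that])
  qed
  moreover have "ip \<sigma> (umul u P) P' * ip \<sigma> P' T = ip \<sigma> (umul u P) T"
    using shift onb_mod_in_span[OF P] by (intro ip_mult_onb[OF P' _ T]) simp
  moreover have "ip \<sigma> P Q * ip \<sigma> (umul u Q) ?R * ip \<sigma> ?R T
      = ip \<sigma> P Q * (ip \<sigma> (umul u Q) ?R * ip \<sigma> ?R T)"
    by (rule assoc_mult_mat[where ?n\<^sub>1 = "dim_vec P" and ?n\<^sub>2 = "dim_vec Q" and ?n\<^sub>3 = "dim_vec Q" and ?n\<^sub>4 = "dim_vec T"])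
      (auto intro: carrier_matI)
  moreover have "ip \<sigma> P Q * ip \<sigma> (umul u Q) T = ip \<sigma> (umul u P) T - ip \<sigma> P T' * ip \<sigma> (umul u T') T"
    unfolding ip_split_umul[OF assms(1-4) u(1) P Q T T', symmetric] by (intro eq_matI) auto
  ultimately show ?thesis
    by simp
qed

section \<open>Shifts and reverses of monomials in rectangles\<close>

lemma zw_monom_Suc:
  "zw_monom (Suc i, j) x = fst x * zw_monom (i, j) x" "zw_monom (i, Suc j) x = snd x * zw_monom (i, j) x"
  by (simp_all add: zw_monom_def case_prod_beta)

lemma fst_shift_in_span:
  assumes "f \<in> zw_span ({..<a} \<times> {..<b})"
  shows "(\<lambda>x. fst x * f x) \<in> zw_span ({..<Suc a} \<times> {..<b})"
proof -
  obtain c where c: "\<And>x. x \<in> bicircle \<Longrightarrow> f x = (\<Sum>k\<in>{..<a} \<times> {..<b}. c k * zw_monom k x)"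
    using assms by (auto elim!: zw_spanE)
  have "(\<lambda>x. \<Sum>k\<in>{..<a} \<times> {..<b}. c k * zw_monom (Suc (fst k), snd k) x) \<in> zw_span ({..<Suc a} \<times> {..<b})"
    by (intro zw_span_sum zw_span_scale zw_monom_in_span) auto
  moreover have "fst x * f x = (\<Sum>k\<in>{..<a} \<times> {..<b}. c k * zw_monom (Suc (fst k), snd k) x)" if "x \<in> bicircle" for x
    using that by (simp add: c sum_distrib_left zw_monom_Suc mult.left_commute)
  ultimately show ?thesis
    unfolding zw_span_def by simp
qed

lemma snd_shift_in_span:
  assumes "f \<in> zw_span ({..<a} \<times> {..<b})"
  shows "(\<lambda>x. snd x * f x) \<in> zw_span ({..<a} \<times> {..<Suc b})"
proof -
  obtain c where c: "\<And>x. x \<in> bicircle \<Longrightarrow> f x = (\<Sum>k\<in>{..<a} \<times> {..<b}. c k * zw_monom k x)"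
    using assms by (auto elim!: zw_spanE)
  have "(\<lambda>x. \<Sum>k\<in>{..<a} \<times> {..<b}. c k * zw_monom (fst k, Suc (snd k)) x) \<in> zw_span ({..<a} \<times> {..<Suc b})"
    by (intro zw_span_sum zw_span_scale zw_monom_in_span) auto
  moreover have "snd x * f x = (\<Sum>k\<in>{..<a} \<times> {..<b}. c k * zw_monom (fst k, Suc (snd k)) x)" if "x \<in> bicircle" for x
    using that by (simp add: c sum_distrib_left zw_monom_Suc mult.left_commute)
  ultimately show ?thesis
    unfolding zw_span_def by simp
qed

text \<open>Reversal turns the exponent \<open>i\<close> of \<open>z\<close> into
  \<open>n - i\<close>. For \<open>i < n\<close> this is at least 1, so a factor \<open>z\<close>
  splits off and the other factor stays in the rectangle.\<close>

lemma rev_fun_monom_fst: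
  assumes "a \<in> {..<n} \<times> {..<Suc m}"
  shows "\<exists>b\<in>{..<n} \<times> {..<Suc m}. \<forall>x\<in>bicircle. rev_fun n m (zw_monom a) x = fst x * zw_monom b x"
proof -
  obtain i j where a: "a = (i, j)" "i < n" "j \<le> m"
    using assms by auto
  then have "n - i = Suc (n - Suc i)"
    by simp
  with a show ?thesis
    by (intro bexI[of _ "(n - Suc i, m - j)"]) (auto simp: rev_fun_monom zw_monom_Suc)
qed

lemma rev_fun_monom_snd:
  assumes "a \<in> {..<Suc n} \<times> {..<m}"
  shows "\<exists>b\<in>{..<Suc n} \<times> {..<m}. \<forall>x\<in>bicircle. rev_fun n m (zw_monom a) x = snd x * zw_monom b x"
proof -
  obtain i j where a: "a = (i, j)" "i \<le> n" "j < m"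
    using assms by auto
  then have "m - j = Suc (m - Suc j)"
    by simp
  with a show ?thesis
    by (intro bexI[of _ "(n - i, m - Suc j)"]) (auto simp: rev_fun_monom zw_monom_Suc)
qed

section \<open>The two identities for \<open>Phi\<close> and \<open>Phi_tilde\<close>\<close>

lemma dim_Phi [simp]: "dim_vec (Phi \<sigma> n m) = Suc m" "dim_vec (Phi_tilde \<sigma> n m) = Suc n"
  by (simp_all add: Phi_def Phi_tilde_def)

lemma Gamma_E_hat_I1:
  "Gamma \<sigma> n (Suc m) * E_hat \<sigma> (Suc n) (Suc m) * I1 \<sigma> n (Suc m)
     = A_mat \<sigma> (Suc n) m * K_mat \<sigma> (Suc n) (Suc m) - K_mat \<sigma> n (Suc m) * Gamma1_tilde \<sigma> n (Suc m)"
proof -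
  \<comment> \<open>For \<open>n = 0\<close> there is no preceding index; the empty vector
    reproduces the explicitly empty matrices of \<open>K_mat\<close> and
    \<open>Gamma1_tilde\<close>, so no separate case of the identity arises.\<close>
  define T where "T = (if n = 0 then vNil else Phi_tilde \<sigma> (n - 1) (Suc m))"
  have T: "onb_mod ({..<n} \<times> {..<Suc (Suc m)}) ({..<n} \<times> {..<Suc m}) T"
    using onb_mod_Phi_tilde[of "n - 1" "Suc m"] by (auto simp: T_def onb_mod_vNil)
  have K: "K_mat \<sigma> n (Suc m) = ip \<sigma> (Phi \<sigma> n m) T"
    by (cases "n = 0") (auto simp: K_mat_def T_def intro!: eq_matI)
  have G: "Gamma1_tilde \<sigma> n (Suc m) = ip \<sigma> (umul fst T) (Phi_tilde \<sigma> n (Suc m))"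
    by (cases "n = 0") (auto simp: Gamma1_tilde_def T_def zmul_eq_umul intro!: eq_matI)
  have cont: "continuous_on bicircle fst"
    by (intro continuous_intros)
  show ?thesis
    \<comment> \<open>The rectangles, given by their numbers of exponents, are \<open>n\<close> by
      \<open>m + 1\<close> for \<open>A\<close>, \<open>n + 1\<close> by \<open>m + 1\<close> for
      \<open>B\<close>, \<open>n\<close> by \<open>m + 2\<close> for \<open>C\<close> and
      \<open>n + 1\<close> by \<open>m + 2\<close> for \<open>D\<close>; \<open>B'\<close> is
      \<open>B\<close> with one more power of \<open>z\<close>.\<close>
    unfolding K G Gamma_def E_hat_def I1_def A_mat_def K_mat_def[of _ "Suc n"] revPhi_def zmul_eq_umul
    using Gamma_E_hat_I1_generic[OF _ _ _ _ cont bicircle_cnj(1) onb_mod_Phi[of n m] onb_mod_Phi[of n "Suc m"]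
        onb_mod_Phi[of "Suc n" m] onb_mod_Phi_tilde[of n "Suc m"] T
        fst_shift_in_span rev_fun_in_span rev_fun_monom_fst]
    by (simp add: Sigma_mono lessThan_subset_iff)
qed

lemma Gamma_tilde_E_tilde_hat_I1_tilde:
  "Gamma_tilde \<sigma> (Suc n) m * E_tilde_hat \<sigma> (Suc n) (Suc m) * I1_tilde \<sigma> (Suc n) m
     = A_tilde \<sigma> n (Suc m) * K_tilde \<sigma> (Suc n) (Suc m) - K_tilde \<sigma> (Suc n) m * Gamma1 \<sigma> (Suc n) m"
proof -
  \<comment> \<open>In the mirrored identity it is \<open>m = 0\<close> that leaves no preceding
    index.\<close>
  define T where "T = (if m = 0 then vNil else Phi \<sigma> (Suc n) (m - 1))"
  have T: "onb_mod ({..<Suc (Suc n)} \<times> {..<m}) ({..<Suc n} \<times> {..<m}) T"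
    using onb_mod_Phi[of "Suc n" "m - 1"] by (auto simp: T_def onb_mod_vNil)
  have K: "K_tilde \<sigma> (Suc n) m = ip \<sigma> (Phi_tilde \<sigma> n m) T"
    by (cases "m = 0") (auto simp: K_tilde_def T_def intro!: eq_matI)
  have G: "Gamma1 \<sigma> (Suc n) m = ip \<sigma> (umul snd T) (Phi \<sigma> (Suc n) m)"
    by (cases "m = 0") (auto simp: Gamma1_def T_def wmul_eq_umul intro!: eq_matI)
  have cont: "continuous_on bicircle snd"
    by (intro continuous_intros)
  show ?thesis
    unfolding K G Gamma_tilde_def E_tilde_hat_def I1_tilde_def A_tilde_def K_tilde_def[of _ _ "Suc m"]
      revPhi_tilde_def wmul_eq_umul
    using Gamma_E_hat_I1_generic[OF _ _ _ _ cont bicircle_cnj(2) onb_mod_Phi_tilde[of n m] onb_mod_Phi_tilde[of "Suc n" m]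
        onb_mod_Phi_tilde[of n "Suc m"] onb_mod_Phi[of "Suc n" m] T
        snd_shift_in_span rev_fun_in_span rev_fun_monom_snd]
    by (simp add: Sigma_mono lessThan_subset_iff)
qed

end

theorem lemma3p2:
  fixes \<sigma> :: "(complex \<times> complex) measure" and n m :: nat
  assumes "nondegenerate_bicircle_measure \<sigma>"
    and "n \<ge> 1" and "m \<ge> 1"
  shows "Gamma \<sigma> (n - 1) m * E_hat \<sigma> n m * I1 \<sigma> (n - 1) m
           = A_mat \<sigma> n (m - 1) * K_mat \<sigma> n m - K_mat \<sigma> (n - 1) m * Gamma1_tilde \<sigma> (n - 1) m
       \<and> Gamma_tilde \<sigma> n (m - 1) * E_tilde_hat \<sigma> n m * I1_tilde \<sigma> n (m - 1)
           = A_tilde \<sigma> (n - 1) m * K_tilde \<sigma> n m - K_tilde \<sigma> n (m - 1) * Gamma1 \<sigma> n (m - 1)"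
proof -
  interpret bicircle_measure \<sigma>
    using assms(1) by unfold_locales
  obtain n' m' where "n = Suc n'" "m = Suc m'"
    using assms(2,3) by (metis Suc_le_D One_nat_def)
  then show ?thesis
    using Gamma_E_hat_I1[of n' m'] Gamma_tilde_E_tilde_hat_I1_tilde[of n' m'] by simp
qed

end
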